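(* For any $(h,t,v)\in i\mathfrak u(n)\oplus\mathbb C^n\oplus\mathbb R$, $$\dim\mathfrak g^0_{(h,t,v)}=\rho_1+\cdots+\rho_\delta$$ and $$\dim\mathfrak g_{(h,t,v)}=\dim\mathfrak g^0_{(h,t,v)}+\tau_1+\cdots+\tau_\delta .$$
   Context: $\mathbb C^n$ ($n\ge1$) consists of columns; $z^*$ denotes conjugate transpose; $\mathfrak u(n)=\{a\in M_n(\mathbb C):a^*=-a\}$, so $i\mathfrak u(n)$ is the space of Hermitian matrices. Dimensions of $\mathfrak g_{(h,t,v)}$ and $\mathfrak g^0_{(h,t,v)}$ are real dimensions. For $(h,t,v)\in i\mathfrak u(n)\oplus\mathbb C^n\oplus\mathbb R$, $\mathfrak g_{(h,t,v)}\subset\mathbb C^n\oplus\mathfrak u(n)$ is the real vector space of solutions $(w,f)\in\mathbb C^n\oplus\mathfrak u(n)$ of the linear equations $$0=hf-fh+t\,w^*+w\,t^*,\qquad 0=-f\,t+\bigl(h^2+(\operatorname{tr}h)\,h+v\,I_n\bigr)w,$$ and $\mathfrak g^0_{(h,t,v)}\subset\mathfrak g_{(h,t,v)}$ is the subspace of solutions with $w=0$. Let $h_1>h_2>\cdots>h_\delta$ be the distinct eigenvalues of $h$, let $L_\alpha\subset\mathbb C^n$ be the $h_\alpha$-eigenspace of $h$, and let $n_\alpha=\dim_{\mathbb C}L_\alpha\ge1$. Write $t=t_1+\cdots+t_\delta$ with $t_\alpha\in L_\alpha$, and set $$v_\alpha=h_\alpha^2+(\operatorname{tr}h)\,h_\alpha+v+\sum_{\beta\ne\alpha}\frac{|t_\beta|^2}{h_\alpha-h_\beta}.$$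 Define $$(\tau_\alpha,\rho_\alpha)=\begin{cases}(1,\,(n_\alpha-1)^2)&\text{if }t_\alpha\ne0,\\(0,\,n_\alpha^2)&\text{if }t_\alpha=0\text{ but }v_\alpha\ne0,\\(2n_\alpha,\,n_\alpha^2)&\text{if }t_\alpha=0\text{ and }v_\alpha=0.\end{cases}$$ *)

theory Defs
  imports "HOL-Analysis.Analysis"
begin

section \<open>Hermitian and skew-Hermitian matrices\<close>

definition conj_transpose :: "complex^'n^'m \<Rightarrow> complex^'m^'n" where
  "conj_transpose A = (\<chi> i j. cnj (A $ j $ i))"

definition hermitian :: "complex^'n^'n \<Rightarrow> bool" where
  "hermitian A \<longleftrightarrow> conj_transpose A = A"

definition unitary_algebra :: "(complex^'n^'n) set" where
  "unitary_algebra = {a. conj_transpose a = - a}"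

text \<open>The square matrix \<open>x y\<^sup>*\<close>, for columns \<open>x\<close> and \<open>y\<close>.\<close>

definition outer :: "complex^'n \<Rightarrow> complex^'n \<Rightarrow> complex^'n^'n" where
  "outer x y = (\<chi> i j. x $ i * cnj (y $ j))"


section \<open>The solution spaces\<close>

text \<open>\<^term>\<open>mat c\<close> is the scalar matrix \<open>c I\<close>, so \<^term>\<open>mat (trace h) ** h\<close> is \<open>(tr h) h\<close>.\<close>

definition sol_space ::
    "complex^'n^'n \<Rightarrow> complex^'n \<Rightarrow> real \<Rightarrow> ((complex^'n) \<times> (complex^'n^'n)) set" where
  "sol_space h t v = {(w, f). f \<in> unitary_algebra \<and>
     0 = h ** f - f ** h + outer t w + outer w t \<and>
     0 = - (f *v t) + (h ** h + mat (trace h) ** h + mat (of_real v)) *v w}"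

definition sol_space0 ::
    "complex^'n^'n \<Rightarrow> complex^'n \<Rightarrow> real \<Rightarrow> ((complex^'n) \<times> (complex^'n^'n)) set" where
  "sol_space0 h t v = {(w, f) \<in> sol_space h t v. w = 0}"

text \<open>
  \<^const>\<open>dim\<close> denotes the real dimension of the real span, so for it to be the real dimension of the
  solution spaces these have to be real subspaces.
\<close>

lemma subspace_sol_space: "subspace (sol_space h t v)"
proof -
  have L: "linear (conj_transpose :: complex^'n^'n \<Rightarrow> _)"
    "linear (\<lambda>x. outer x y)" "linear (outer y)"
    "linear (\<lambda>A. A ** B)" "linear ((**) B)" "linear (\<lambda>A. A *v y)" "linear ((*v) B)"
    for y :: "complex^'n" and B :: "complex^'n^'n"
    by (rule linearI; simp add: conj_transpose_def outer_def matrix_matrix_mult_def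
        matrix_vector_mult_def vec_eq_iff sum.distrib algebra_simps scaleR_sum_right)+
  show ?thesis
    unfolding subspace_def sol_space_def unitary_algebra_def
    by (auto simp: zero_prod_def L[THEN linear_0] L[THEN linear_add] L[THEN linear_cmul]
        algebra_simps)
qed

lemma subspace_sol_space0:
  fixes h :: "complex^'n^'n"
  shows "subspace (sol_space0 h t v)"
proof -
  have "sol_space0 h t v = sol_space h t v \<inter> {p. fst p = 0}"
    by (auto simp: sol_space0_def)
  moreover have "subspace {p :: (complex^'n) \<times> (complex^'n^'n). fst p = 0}"
    by (simp add: subspace_def)
  ultimately show ?thesis by (simp add: subspace_Int subspace_sol_space subspace_inter)
qed


section \<open>Spectral data of a Hermitian matrix\<close>

definition eigenspace :: "complex^'n^'n \<Rightarrow> complex \<Rightarrow> (complex^'n) set" where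
  "eigenspace h c = {u. h *v u = c *s u}"

text \<open>
  Only real eigenvalues are collected: below, a Hermitian matrix is shown to have no others. The
  distinct eigenvalues themselves serve as indices in place of \<open>1, \<dots>, \<delta>\<close>.
\<close>

definition eigenvalues :: "complex^'n^'n \<Rightarrow> real set" where
  "eigenvalues h = {x. \<exists>u \<in> eigenspace h (of_real x). u \<noteq> 0}"

definition mult_eig :: "complex^'n^'n \<Rightarrow> real \<Rightarrow> nat" where
  "mult_eig h x = vec.dim (eigenspace h (of_real x))"

lemma hermitian_cinner:
  assumes "hermitian h"
  shows "(\<Sum>i\<in>UNIV. (h *v u) $ i * cnj (w $ i)) = (\<Sum>i\<in>UNIV. u $ i * cnj ((h *v w) $ i))"
proof -
  have h: "cnj (h $ i $ j) = h $ j $ i" for i j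
    using assms by (simp add: hermitian_def conj_transpose_def vec_eq_iff)
  have "(\<Sum>i\<in>UNIV. (h *v u) $ i * cnj (w $ i)) =
      (\<Sum>i\<in>UNIV. \<Sum>j\<in>UNIV. h $ i $ j * u $ j * cnj (w $ i))"
    by (simp add: matrix_vector_mult_def sum_distrib_right)
  also have "\<dots> = (\<Sum>j\<in>UNIV. \<Sum>i\<in>UNIV. h $ i $ j * u $ j * cnj (w $ i))"
    by (rule sum.swap)
  also have "\<dots> = (\<Sum>j\<in>UNIV. u $ j * cnj ((h *v w) $ j))"
    by (simp add: matrix_vector_mult_def sum_distrib_left h ac_simps)
  finally show ?thesis .
qed

lemma hermitian_eigenvalue_real:
  assumes "hermitian h" "u \<in> eigenspace h c" "u \<noteq> 0"
  shows "c \<in> \<real>"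
proof -
  have hu: "h *v u = c *s u" using assms by (simp add: eigenspace_def)
  let ?s = "\<Sum>i\<in>UNIV. u $ i * cnj (u $ i)"
  have "c * ?s = cnj c * ?s"
    using hermitian_cinner[OF assms(1), of u u]
    by (simp add: hu sum_distrib_left ac_simps)
  moreover have "?s = of_real (\<Sum>i\<in>UNIV. (cmod (u $ i))\<^sup>2)"
    by (simp add: complex_mult_cnj cmod_power2)
  moreover have "(\<Sum>i\<in>UNIV. (cmod (u $ i))\<^sup>2) \<noteq> 0"
    using assms(3) by (auto simp: sum_nonneg_eq_0_iff vec_eq_iff)
  ultimately have "c = cnj c" by (metis mult_cancel_right of_real_eq_0_iff)
  then show ?thesis by (simp add: Reals_cnj_iff)
qed

lemma finite_eigenvalues:
  fixes h :: "complex^'n^'n"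
  assumes "hermitian h"
  shows "finite (eigenvalues h)"
proof -
  obtain U where U: "\<And>x. x \<in> eigenvalues h \<Longrightarrow> U x \<noteq> 0 \<and> h *v U x = of_real x *s U x"
  proof -
    have "\<forall>x. \<exists>u. x \<in> eigenvalues h \<longrightarrow> u \<noteq> 0 \<and> h *v u = of_real x *s u"
      by (auto simp: eigenvalues_def eigenspace_def)
    then show ?thesis using that by metis
  qed
  have orth: "U x \<bullet> U y = 0" if "x \<in> eigenvalues h" "y \<in> eigenvalues h" "x \<noteq> y" for x y
  proof -
    let ?s = "\<Sum>i\<in>UNIV. U x $ i * cnj (U y $ i)"
    have "of_real x * ?s = of_real y * ?s"
      using hermitian_cinner[OF assms, of "U x" "U y"] U[OF that(1)] U[OF that(2)]
      by (simp add: sum_distrib_left ac_simps)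
    then have "?s = 0" using that(3) by simp
    moreover have "U x \<bullet> U y = Re ?s" by (simp add: inner_vec_def inner_complex_def)
    ultimately show ?thesis by simp
  qed
  have "inj_on U (eigenvalues h)"
    using orth U by (intro inj_onI) (metis inner_eq_zero_iff)
  moreover have "pairwise orthogonal (U ` eigenvalues h)"
    using orth by (auto simp: pairwise_def orthogonal_def)
  then have "finite (U ` eigenvalues h)" by (rule pairwise_orthogonal_imp_finite)
  ultimately show ?thesis using finite_imageD by blast
qed

text \<open>
  The family \<open>(t\<^sub>x)\<close> with \<open>t\<^sub>x\<close> in the \<open>x\<close>-eigenspace and \<open>t = \<Sum>\<^sub>x t\<^sub>x\<close>; it exists and is unique when
  \<open>h\<close> is Hermitian. For \<open>x\<close> not an eigenvalue the eigenspace is zero, hence so is \<open>t\<^sub>x\<close>.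
\<close>

definition eig_comp :: "complex^'n^'n \<Rightarrow> complex^'n \<Rightarrow> real \<Rightarrow> complex^'n" where
  "eig_comp h t = (THE s. (\<forall>x. s x \<in> eigenspace h (of_real x)) \<and> t = (\<Sum>x\<in>eigenvalues h. s x))"

text \<open>The trace of a Hermitian matrix is real.\<close>

definition v_eig :: "complex^'n^'n \<Rightarrow> complex^'n \<Rightarrow> real \<Rightarrow> real \<Rightarrow> real" where
  "v_eig h t v x = x\<^sup>2 + Re (trace h) * x + v +
     (\<Sum>y\<in>eigenvalues h - {x}. (norm (eig_comp h t y))\<^sup>2 / (x - y))"

definition tau :: "complex^'n^'n \<Rightarrow> complex^'n \<Rightarrow> real \<Rightarrow> real \<Rightarrow> nat" where
  "tau h t v x =
     (if eig_comp h t x \<noteq> 0 then 1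
      else if v_eig h t v x \<noteq> 0 then 0
      else 2 * mult_eig h x)"

definition rho :: "complex^'n^'n \<Rightarrow> complex^'n \<Rightarrow> real \<Rightarrow> nat" where
  "rho h t x = (if eig_comp h t x \<noteq> 0 then (mult_eig h x - 1)\<^sup>2 else (mult_eig h x)\<^sup>2)"

end

theory Submission
  imports Defs
begin

text \<open>
  Choose an orthonormal eigenbasis of \<open>h\<close> containing all the normalised nonzero components of \<open>t\<close>, so
  that \<open>t\<close> has at most one nonzero coordinate \<open>c\<^sub>i\<close> per eigenvalue, and \<open>c\<^sub>i\<close> is real. With \<open>d\<^sub>i\<close> the
  eigenvalue of the \<open>i\<close>-th basis vector, the equations become
  \<open>(d\<^sub>i - d\<^sub>j) f\<^sub>i\<^sub>j + c\<^sub>i cnj w\<^sub>j + w\<^sub>i c\<^sub>j = 0\<close> and \<open>\<Sum>\<^sub>j f\<^sub>i\<^sub>j c\<^sub>j = (d\<^sub>i\<^sup>2 + tr h d\<^sub>i + v) w\<^sub>i\<close>.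
  For \<open>w = 0\<close> they say that the skew-Hermitian matrix \<open>f\<close> is supported on the pairs with
  \<open>d\<^sub>i = d\<^sub>j\<close> and \<open>c\<^sub>i = c\<^sub>j = 0\<close>. In general the first equation determines \<open>f\<^sub>i\<^sub>j\<close> for \<open>d\<^sub>i \<noteq> d\<^sub>j\<close>;
  for \<open>d\<^sub>i = d\<^sub>j\<close> it forces \<open>w\<^sub>i\<close> to be imaginary if \<open>c\<^sub>i \<noteq> 0\<close>, and to vanish if \<open>c\<^sub>i = 0\<close> but the
  \<open>d\<^sub>i\<close>-component of \<open>t\<close> is not zero. The second equation can be solved by the diagonal entry \<open>f\<^sub>i\<^sub>i\<close>
  if \<open>c\<^sub>i \<noteq> 0\<close>, and becomes \<open>v_eig w\<^sub>i = 0\<close> if the \<open>d\<^sub>i\<close>-component of \<open>t\<close> vanishes. So the possible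
  \<open>w\<close> form a coordinate subspace, and the claim follows by rank-nullity.
\<close>

section \<open>Orthonormal eigenbases\<close>

definition cinner :: "complex^'n \<Rightarrow> complex^'n \<Rightarrow> complex" where
  "cinner x y = (\<Sum>i\<in>UNIV. x $ i * cnj (y $ i))"

lemma cinner_simps:
  "cinner (x + y) z = cinner x z + cinner y z"
  "cinner (x - y) z = cinner x z - cinner y z"
  "cinner (a *s x) z = a * cinner x z"
  "cinner x (a *s z) = cnj a * cinner x z"
  "cinner 0 z = 0"
  "cinner x 0 = 0"
  by (simp_all add: cinner_def sum.distrib sum_subtractf sum_distrib_left algebra_simps)

lemma cinner_sum_left: "cinner (\<Sum>k\<in>A. g k) z = (\<Sum>k\<in>A. cinner (g k) z)"
  by (induction A rule: infinite_finite_induct) (simp_all add: cinner_simps)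

lemma cinner_commute: "cinner y x = cnj (cinner x y)"
  by (simp add: cinner_def mult.commute)

text \<open>Links the complex inner product with the Euclidean one, so that real results on
  orthogonality, norms and self-adjoint maps apply to columns.\<close>

lemma inner_eq_Re_cinner: "x \<bullet> y = Re (cinner x y)"
  by (simp add: cinner_def inner_vec_def inner_complex_def)

lemma cinner_self: "cinner x x = of_real ((norm x)\<^sup>2)"
proof -
  have "Im (cinner x x) = 0"
    by (simp add: cinner_def)
  then show ?thesis
    by (simp add: complex_eq_iff power2_norm_eq_inner inner_eq_Re_cinner)
qed

lemma scaleR_eq_vector_smult: "r *\<^sub>R (x :: complex^'n) = of_real r *s x"
  by (simp add: vec_eq_iff scaleR_conv_of_real[where 'a=complex])

section \<open>Existence of eigenvectors and extension to orthonormal eigenbases\<close>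

text \<open>A maximiser of the Rayleigh quotient on the unit sphere of \<open>S\<close> is an
  eigenvector. Working over the reals makes the eigenvalue real; allowing an invariant subspace
  makes the result applicable to orthogonal complements.\<close>

lemma selfadjoint_eigenvector:
  fixes f :: "'a::euclidean_space \<Rightarrow> 'a"
  assumes "subspace S" "S \<noteq> {0}" "linear f" "\<And>x. x \<in> S \<Longrightarrow> f x \<in> S"
    and adj: "\<And>x y. f x \<bullet> y = x \<bullet> f y"
  obtains u c where "u \<in> S" "norm u = 1" "f u = c *\<^sub>R u"
proof -
  let ?K = "S \<inter> sphere 0 1"
  have "compact ?K"
    using closed_subspace[OF assms(1)] by (simp add: closed_Int_compact)
  moreover have "?K \<noteq> {}"
  proof -
    obtain x where x: "x \<in> S" "x \<noteq> 0"
      using assms(1,2) subspace_0 by blast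
    then have "(1 / norm x) *\<^sub>R x \<in> ?K"
      using assms(1) by (simp add: subspace_scale)
    then show ?thesis by blast
  qed
  moreover have "continuous_on ?K (\<lambda>x. f x \<bullet> x)"
    using assms(3) by (intro continuous_intros linear_continuous_on linear_linear[THEN iffD2])
  ultimately have "\<exists>u\<in>?K. \<forall>y\<in>?K. f y \<bullet> y \<le> f u \<bullet> u"
    by (rule continuous_attains_sup)
  then obtain u where u: "u \<in> ?K" and max: "\<And>y. y \<in> ?K \<Longrightarrow> f y \<bullet> y \<le> f u \<bullet> u"
    by blast
  define c where "c = f u \<bullet> u"
  \<comment> \<open>Homogeneity carries the bound from the unit sphere to all of
    \<open>S\<close>.\<close>
  have le: "f x \<bullet> x \<le> c * (x \<bullet> x)" if "x \<in> S" for x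
  proof (cases "x = 0")
    case True
    then show ?thesis using linear_0[OF assms(3)] by simp
  next
    case False
    let ?y = "(1 / norm x) *\<^sub>R x"
    have "?y \<in> ?K"
      using that False assms(1) by (simp add: subspace_scale)
    from max[OF this] have "(f x \<bullet> x) / (x \<bullet> x) \<le> c"
      by (simp add: linear_cmul[OF assms(3)] c_def dot_square_norm power2_eq_square)
    then show ?thesis
      using False by (simp add: divide_le_eq)
  qed
  define y where "y = f u - c *\<^sub>R u"
  have yS: "y \<in> S"
    using u assms(1,4) by (simp add: y_def subspace_diff subspace_scale)
  have uu: "u \<bullet> u = 1"
    using u by (simp add: dot_square_norm)
  \<comment> \<open>Perturb the maximiser \<open>u\<close> in the direction of the residual
    \<open>y\<close>. The terms without \<open>e\<close> and the multiples of
    \<open>u \<bullet> y\<close> cancel, and division by \<open>e\<close> leaves a bound that tends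
    to 0 with \<open>e\<close>.\<close>
  have *: "2 * (y \<bullet> y) \<le> e * (c * (y \<bullet> y) - f y \<bullet> y)" if "e > 0" for e :: real
  proof -
    have "u + e *\<^sub>R y \<in> S"
      using u yS assms(1) by (simp add: subspace_add subspace_scale)
    from le[OF this]
    have "f u \<bullet> u + e * (f u \<bullet> y) + e * (f y \<bullet> u) + e * e * (f y \<bullet> y)
        \<le> c * (u \<bullet> u + 2 * e * (u \<bullet> y) + e * e * (y \<bullet> y))"
      by (simp add: linear_add[OF assms(3)] linear_cmul[OF assms(3)] inner_simps inner_commute
          algebra_simps)
    moreover have "f y \<bullet> u = f u \<bullet> y"
      using adj[of y u] by (simp add: inner_commute)
    moreover have "f u \<bullet> y = y \<bullet> y + c * (u \<bullet> y)"
      by (simp add: y_def inner_simps inner_commute[of u "f u"])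
    ultimately have "e * (2 * (y \<bullet> y)) \<le> e * (e * (c * (y \<bullet> y) - f y \<bullet> y))"
      by (simp add: uu c_def[symmetric] algebra_simps)
    then show ?thesis using that by simp
  qed
  have "y \<bullet> y = 0"
  proof (rule ccontr)
    assume "y \<bullet> y \<noteq> 0"
    then have pos: "y \<bullet> y > 0" by simp
    \<comment> \<open>The case \<open>e = 1\<close> shows that \<open>?k\<close> is positive; then
      \<open>e = (y \<bullet> y) / ?k\<close> turns the bound into
      \<open>2 * (y \<bullet> y) \<le> y \<bullet> y\<close>.\<close>
    let ?k = "c * (y \<bullet> y) - f y \<bullet> y"
    have "0 < 2 * (y \<bullet> y)" using pos by simp
    also have "\<dots> \<le> ?k" using *[OF zero_less_one] by simp
    finally have k: "?k > 0" .
    from *[of "(y \<bullet> y) / ?k"] pos k show False by simp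
  qed
  then have "f u = c *\<^sub>R u" by (simp add: y_def)
  then show thesis using that u by auto
qed

definition orthonormal_eigenvectors :: "complex^'n^'n \<Rightarrow> (complex^'n) set \<Rightarrow> bool" where
  "orthonormal_eigenvectors h B \<longleftrightarrow>
     (\<forall>a\<in>B. \<forall>b\<in>B. cinner a b = (if a = b then 1 else 0)) \<and>
     (\<forall>b\<in>B. \<exists>c::real. h *v b = of_real c *s b)"

lemma orthonormal_independent:
  assumes "\<forall>a\<in>B. \<forall>b\<in>B. cinner a b = (if a = b then 1 else 0)"
  shows "vec.independent B"
proof -
  have "\<forall>a\<in>B. a \<noteq> 0"
    using assms by (metis cinner_simps(5) zero_neq_one)
  \<comment> \<open>Complex orthogonality implies real orthogonality, and a real orthogonal set is
    finite.\<close>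
  moreover have "pairwise orthogonal B"
    using assms by (auto simp: pairwise_def orthogonal_def inner_eq_Re_cinner)
  ultimately have fin: "finite B"
    using pairwise_orthogonal_imp_finite by blast
  show ?thesis
  proof (rule vec.independent_if_scalars_zero[OF fin])
    fix f x assume z: "(\<Sum>x\<in>B. f x *s x) = 0" and x: "x \<in> B"
    have "0 = cinner (\<Sum>x\<in>B. f x *s x) x"
      by (simp add: z cinner_simps)
    also have "\<dots> = (\<Sum>y\<in>B. if y = x then f y else 0)"
      using assms x by (auto simp: cinner_sum_left cinner_simps intro!: sum.cong)
    finally show "f x = 0"
      using fin x by simp
  qed
qed

text \<open>Take an extension of maximal cardinality. If it did not span, its orthogonal complement
  would be a nonzero \<open>h\<close>-invariant subspace and would supply one more unit
  eigenvector.\<close>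

lemma orthonormal_eigenvectors_extend:
  fixes h :: "complex^'n^'n"
  assumes "hermitian h" "orthonormal_eigenvectors h B0"
  obtains B where "B0 \<subseteq> B" "orthonormal_eigenvectors h B" "finite B" "card B = CARD('n)"
proof -
  let ?P = "\<lambda>B. B0 \<subseteq> B \<and> orthonormal_eigenvectors h B"
  have ind: "vec.independent B" if "orthonormal_eigenvectors h B" for B
    using that orthonormal_independent by (auto simp: orthonormal_eigenvectors_def)
  have bound: "card B \<le> CARD('n)" if "orthonormal_eigenvectors h B" for B
    using vec.independent_card_le_dim[OF subset_UNIV ind[OF that]] by (simp only: vec_dim_card)
  obtain B where B: "?P B" and max: "\<And>C. ?P C \<Longrightarrow> card C \<le> card B"
    using ex_has_greatest_nat[of ?P B0 card "Suc CARD('n)"] assms(2) bound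
    by (metis le_imp_less_Suc order_refl)
  have fin: "finite B"
    using ind B vec.finiteI_independent by blast
  have "card B = CARD('n)"
  proof (rule ccontr)
    assume ne: "card B \<noteq> CARD('n)"
    have "vec.span B \<noteq> UNIV"
    proof
      assume sp: "vec.span B = UNIV"
      have "vec.dim (UNIV :: (complex^'n) set) = card B"
        using vec.dim_span_eq_card_independent[OF ind] B sp by metis
      with ne show False by (simp only: vec_dim_card)
    qed
    then obtain x where x: "x \<notin> vec.span B" by blast
    define S where "S = {x. \<forall>b\<in>B. cinner x b = 0}"
    \<comment> \<open>The orthogonal projection to the span of \<open>B\<close> is subtracted from
      \<open>x\<close>; the rest is nonzero because \<open>x\<close> lies outside that span.\<close>
    let ?y = "x - (\<Sum>b\<in>B. cinner x b *s b)"
    have "?y \<in> S"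
      unfolding S_def
    proof safe
      fix a assume a: "a \<in> B"
      have "(\<Sum>b\<in>B. cinner x b * cinner b a) = (\<Sum>b\<in>B. if b = a then cinner x b else 0)"
        using B a by (intro sum.cong) (auto simp: orthonormal_eigenvectors_def)
      then show "cinner ?y a = 0"
        using fin a by (simp add: cinner_simps cinner_sum_left)
    qed
    moreover have "?y \<noteq> 0"
    proof
      assume "?y = 0"
      then have "x = (\<Sum>b\<in>B. cinner x b *s b)" by simp
      also have "\<dots> \<in> vec.span B"
        by (intro vec.span_sum vec.span_scale vec.span_base)
      finally show False using x by simp
    qed
    ultimately have "S \<noteq> {0}" by blast
    moreover have "subspace S"
      by (auto simp: subspace_def S_def cinner_simps scaleR_eq_vector_smult)
    moreover have "linear ((*v) h)"
      by (rule linearI) (simp_all add: matrix_vector_right_distrib scaleR_eq_vector_smult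
          vector_scalar_commute)
    moreover have adj: "cinner (h *v x) y = cinner x (h *v y)" for x y
      using hermitian_cinner[OF assms(1)] by (simp add: cinner_def)
    have "h *v x \<in> S" if "x \<in> S" for x
      unfolding S_def
    proof safe
      fix b assume b: "b \<in> B"
      then obtain c :: real where "h *v b = of_real c *s b"
        using B unfolding orthonormal_eigenvectors_def by blast
      then show "cinner (h *v x) b = 0"
        using that b by (simp add: adj cinner_simps S_def)
    qed
    moreover have "(h *v x) \<bullet> y = x \<bullet> (h *v y)" for x y
      by (simp add: inner_eq_Re_cinner adj)
    ultimately obtain u c where u: "u \<in> S" "norm u = 1" "h *v u = c *\<^sub>R u"
      using selfadjoint_eigenvector[of S "(*v) h"] by blast
    have uu: "cinner u u = 1"
      using u by (simp add: cinner_self)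
    have uB: "cinner u b = 0" "cinner b u = 0" if "b \<in> B" for b
      using u that cinner_commute[of b u] by (simp_all add: S_def)
    have "u \<notin> B" using uu uB by force
    have "?P (insert u B)"
      using B u(3) \<open>u \<notin> B\<close> uu uB
      by (auto simp: orthonormal_eigenvectors_def scaleR_eq_vector_smult)
    from max[OF this] show False
      using \<open>u \<notin> B\<close> fin by simp
  qed
  with that B fin show thesis by blast
qed

section \<open>Coordinates with respect to an orthonormal eigenbasis\<close>

text \<open>Indexing the basis by the coordinate type makes the base change a square matrix. The map
  \<open>d\<close> need not be injective: it takes each eigenvalue as often as its
  multiplicity.\<close>

locale eigenbasis =
  fixes h :: "complex^'n^'n" and e :: "'n \<Rightarrow> complex^'n" and d :: "'n \<Rightarrow> real"
  assumes orthonormal: "cinner (e i) (e j) = (if i = j then 1 else 0)"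
    and eigenvector: "h *v e i = of_real (d i) *s e i"
begin

text \<open>The unitary base change: \<open>U\<close> takes coordinates to vectors, its conjugate
  transpose takes vectors to coordinates.\<close>

definition U :: "complex^'n^'n" where
  "U = (\<chi> i j. e j $ i)"

lemma conj_transpose_U_mult: "conj_transpose U ** U = mat 1"
proof -
  have "(conj_transpose U ** U) $ i $ j = cinner (e j) (e i)" for i j
    by (simp add: matrix_matrix_mult_def conj_transpose_def U_def cinner_def mult.commute)
  then show ?thesis
    by (auto simp: vec_eq_iff orthonormal mat_def)
qed

lemma U_mult_conj_transpose: "U ** conj_transpose U = mat 1"
  using conj_transpose_U_mult matrix_left_right_inverse by blast

lemma U_mult_vec: "U *v x = (\<Sum>i\<in>UNIV. x $ i *s e i)"
  by (simp add: vec_eq_iff matrix_vector_mult_def U_def mult.commute)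

lemma conj_transpose_U_mult_vec: "(conj_transpose U *v x) $ i = cinner x (e i)"
  by (simp add: matrix_vector_mult_def conj_transpose_def U_def cinner_def mult.commute)

lemma expansion: "x = (\<Sum>i\<in>UNIV. cinner x (e i) *s e i)"
proof -
  have "x = U *v (conj_transpose U *v x)"
    by (simp add: matrix_vector_mul_assoc U_mult_conj_transpose)
  then show ?thesis
    by (simp add: U_mult_vec conj_transpose_U_mult_vec)
qed

lemma mult_vec_expansion: "h *v x = (\<Sum>i\<in>UNIV. (of_real (d i) * cinner x (e i)) *s e i)"
proof -
  have "h *v x = (\<Sum>i\<in>UNIV. h *v (cinner x (e i) *s e i))"
    by (subst expansion[of x]) (rule vec.linear_sum[OF matrix_vector_mul_linear_gen])
  then show ?thesis
    by (simp add: vector_scalar_commute eigenvector vector_smult_assoc mult.commute)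
qed

lemma cinner_sum_basis: "cinner (\<Sum>i\<in>UNIV. g i *s e i) (e j) = g j"
proof -
  have "cinner (\<Sum>i\<in>UNIV. g i *s e i) (e j) = (\<Sum>i\<in>UNIV. if i = j then g i else 0)"
    by (simp add: cinner_sum_left cinner_simps orthonormal mult_delta_right)
  then show ?thesis by simp
qed

lemma eq_iff_cinner: "x = y \<longleftrightarrow> (\<forall>i. cinner x (e i) = cinner y (e i))"
  by (metis (no_types, lifting) expansion sum.cong)

lemma parseval: "cinner x y = (\<Sum>i\<in>UNIV. cinner x (e i) * cnj (cinner y (e i)))"
proof -
  have "cinner x y = (\<Sum>i\<in>UNIV. cinner x (e i) * cinner (e i) y)"
    by (subst expansion[of x]) (simp add: cinner_sum_left cinner_simps)
  moreover have "cinner (e i) y = cnj (cinner y (e i))" for i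
    by (rule cinner_commute)
  ultimately show ?thesis by simp
qed

lemma eigenspace_iff:
  "x \<in> eigenspace h (of_real a) \<longleftrightarrow> (\<forall>i. d i \<noteq> a \<longrightarrow> cinner x (e i) = 0)"
proof -
  have "x \<in> eigenspace h (of_real a) \<longleftrightarrow>
      (\<forall>i. of_real (d i) * cinner x (e i) = of_real a * cinner x (e i))"
    unfolding eigenspace_def mem_Collect_eq eq_iff_cinner[of "h *v x"]
    by (simp add: mult_vec_expansion cinner_sum_basis cinner_simps)
  then show ?thesis by auto
qed

lemma basis_nonzero: "e i \<noteq> 0"
  using orthonormal[of i i] by (auto simp: cinner_simps)

lemma eigenvalues_eq: "eigenvalues h = range d"
proof safe
  fix a assume "a \<in> eigenvalues h"
  then obtain x where x: "x \<in> eigenspace h (of_real a)" "x \<noteq> 0"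
    by (auto simp: eigenvalues_def)
  then obtain i where "cinner x (e i) \<noteq> 0"
    using eq_iff_cinner[of x 0] by (auto simp: cinner_simps)
  with x have "d i = a" by (auto simp: eigenspace_iff)
  then show "a \<in> range d" by blast
next
  fix i
  have "e i \<in> eigenspace h (of_real (d i))"
    by (simp add: eigenspace_def eigenvector)
  then show "d i \<in> eigenvalues h"
    using basis_nonzero by (auto simp: eigenvalues_def)
qed

text \<open>\<open>U\<close> maps the coordinate subspace of the indices with \<open>d i = a\<close>
  isomorphically onto the eigenspace.\<close>

lemma mult_eig_eq: "mult_eig h a = card {i. d i = a}"
proof -
  let ?A = "{x::complex^'n. \<forall>i. i \<notin> {i. d i = a} \<longrightarrow> x $ i = 0}"
  have "eigenspace h (of_real a) = (*v) U ` ?A"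
  proof (intro equalityI subsetI)
    fix x assume "x \<in> eigenspace h (of_real a)"
    then have "conj_transpose U *v x \<in> ?A"
      by (simp add: eigenspace_iff conj_transpose_U_mult_vec)
    moreover have "x = U *v (conj_transpose U *v x)"
      by (simp add: matrix_vector_mul_assoc U_mult_conj_transpose)
    ultimately show "x \<in> (*v) U ` ?A" by blast
  next
    fix x assume "x \<in> (*v) U ` ?A"
    then show "x \<in> eigenspace h (of_real a)"
      by (auto simp: eigenspace_iff U_mult_vec cinner_sum_basis)
  qed
  moreover have "inj_on ((*v) U) (vec.span ?A)"
    by (rule inj_on_inverseI[where g = "(*v) (conj_transpose U)"])
      (simp add: matrix_vector_mul_assoc conj_transpose_U_mult)
  ultimately have "mult_eig h a = vec.dim ?A"
    unfolding mult_eig_def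
    by (metis (lifting) matrix_vector_mul_linear_gen vec.dim_image_eq)
  then show ?thesis
    by (simp only: dim_substandard_cart)
qed

text \<open>Resolves the definite description: the partial expansions of \<open>t\<close> form such
  a family, and any such family has the same coordinates.\<close>

lemma eig_comp_eq: "eig_comp h t a = (\<Sum>i | d i = a. cinner t (e i) *s e i)"
proof -
  let ?s = "\<lambda>a. \<Sum>i | d i = a. cinner t (e i) *s e i"
  have coord: "cinner (?s a) (e j) = (if d j = a then cinner t (e j) else 0)" for a j
  proof -
    have "?s a = (\<Sum>i\<in>UNIV. (if d i = a then cinner t (e i) else 0) *s e i)"
      by (rule sum.mono_neutral_cong_left) auto
    then show ?thesis by (simp add: cinner_sum_basis)
  qed
  \<comment> \<open>Only the summand for the eigenvalue \<open>d j\<close> has a nonzero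
    \<open>j\<close>-th coordinate.\<close>
  have dec: "cinner (\<Sum>x\<in>eigenvalues h. s x) (e j) = cinner (s (d j)) (e j)"
    if "\<forall>x. s x \<in> eigenspace h (of_real x)" for s j
  proof -
    have "(\<Sum>x\<in>eigenvalues h. cinner (s x) (e j)) =
        (\<Sum>x\<in>eigenvalues h. if x = d j then cinner (s x) (e j) else 0)"
      using that by (auto simp: eigenspace_iff intro!: sum.cong)
    then show ?thesis
      by (simp add: cinner_sum_left eigenvalues_eq)
  qed
  have "eig_comp h t = ?s"
    unfolding eig_comp_def
  proof (rule the_equality)
    have mem: "\<forall>x. ?s x \<in> eigenspace h (of_real x)"
      unfolding eigenspace_iff coord by simp
    moreover have "t = (\<Sum>x\<in>eigenvalues h. ?s x)"
      unfolding eq_iff_cinner[of t] dec[OF mem] coord by simp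
    ultimately show "(\<forall>x. ?s x \<in> eigenspace h (of_real x)) \<and> t = (\<Sum>x\<in>eigenvalues h. ?s x)"
      by blast
  next
    fix s assume s: "(\<forall>x. s x \<in> eigenspace h (of_real x)) \<and> t = (\<Sum>x\<in>eigenvalues h. s x)"
    then have t: "cinner t (e j) = cinner (s (d j)) (e j)" for j
      using dec by metis
    \<comment> \<open>This also settles the values of \<open>s\<close> at reals that are not
      eigenvalues, which do not enter the sum.\<close>
    have z: "cinner (s x) (e j) = 0" if "d j \<noteq> x" for x j
      using s that by (auto simp: eigenspace_iff)
    show "s = ?s"
      unfolding fun_eq_iff eq_iff_cinner coord using t z by auto
  qed
  then show ?thesis by simp
qed

lemma cinner_eig_comp: "cinner (eig_comp h t a) (e j) = (if d j = a then cinner t (e j) else 0)"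
proof -
  have "eig_comp h t a = (\<Sum>i\<in>UNIV. (if d i = a then cinner t (e i) else 0) *s e i)"
    unfolding eig_comp_eq by (rule sum.mono_neutral_cong_left) auto
  then show ?thesis by (simp add: cinner_sum_basis)
qed

end

text \<open>Applied twice below: to the empty set for an auxiliary basis, then to the normalised
  components of \<open>t\<close>.\<close>

lemma eigenbasis_extend:
  fixes h :: "complex^'n^'n"
  assumes "hermitian h" "orthonormal_eigenvectors h B0"
  obtains e d where "eigenbasis h e d" "B0 \<subseteq> range e"
proof -
  obtain B where B: "B0 \<subseteq> B" "orthonormal_eigenvectors h B" "finite B" "card B = CARD('n)"
    using orthonormal_eigenvectors_extend[OF assms] .
  obtain e :: "'n \<Rightarrow> complex^'n" where e: "bij_betw e UNIV B"
    using finite_same_card_bij[of "UNIV :: 'n set" B] B by auto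
  have eB: "e i \<in> B" for i
    using e by (auto simp: bij_betw_def)
  have "\<forall>i. \<exists>c::real. h *v e i = of_real c *s e i"
    using B(2) eB by (auto simp: orthonormal_eigenvectors_def)
  then obtain d where d: "\<And>i. h *v e i = of_real (d i) *s e i"
    by metis
  have "e i = e j \<longleftrightarrow> i = j" for i j
    using e by (auto simp: bij_betw_def inj_def)
  then have "cinner (e i) (e j) = (if i = j then 1 else 0)" for i j
    using B(2) eB by (auto simp: orthonormal_eigenvectors_def)
  with d have "eigenbasis h e d" by unfold_locales
  moreover have "B0 \<subseteq> range e"
    using e B(1) by (simp add: bij_betw_def)
  ultimately show thesis by (rule that)
qed

section \<open>Eigenbases adapted to \<open>t\<close>\<close>

locale adapted_eigenbasis = eigenbasis h e d
  for h :: "complex^'n^'n" and e d +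
  fixes t :: "complex^'n" and c :: "'n \<Rightarrow> real"
  assumes coeff: "cinner t (e i) = of_real (c i)"
    and coeff_unique: "d i = d j \<Longrightarrow> c i \<noteq> 0 \<Longrightarrow> c j \<noteq> 0 \<Longrightarrow> i = j"

text \<open>An arbitrary eigenbasis gives access to the components of \<open>t\<close>. Their
  normalisations are orthonormal eigenvectors, and every other vector of an eigenbasis containing
  them is orthogonal to \<open>t\<close>.\<close>

lemma adapted_eigenbasis_exists:
  fixes h :: "complex^'n^'n"
  assumes "hermitian h"
  obtains e d c where "adapted_eigenbasis h e d t c"
proof -
  have "orthonormal_eigenvectors h {}"
    by (simp add: orthonormal_eigenvectors_def)
  then obtain e' d' where "eigenbasis h e' d'"
    using eigenbasis_extend[OF assms] by metis
  then interpret E: eigenbasis h e' d' .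
  let ?s = "eig_comp h t"
  define b where "b x = of_real (1 / norm (?s x)) *s ?s x" for x
  define B0 where "B0 = b ` {x. ?s x \<noteq> 0}"
  have eig: "?s x \<in> eigenspace h (of_real x)" for x
    by (simp add: E.eigenspace_iff E.cinner_eig_comp)
  \<comment> \<open>\<open>t\<close> and its component \<open>?s x\<close> differ by a vector
    orthogonal to \<open>?s x\<close>. That the value is real is what makes the coefficients
    \<open>c\<close> real.\<close>
  have ts: "cinner t (?s x) = of_real ((norm (?s x))\<^sup>2)" for x
  proof -
    have "cinner t (?s x) = (\<Sum>i\<in>UNIV. cinner t (e' i) * cnj (cinner (?s x) (e' i)))"
      by (rule E.parseval)
    also have "\<dots> = (\<Sum>i\<in>UNIV. cinner (?s x) (e' i) * cnj (cinner (?s x) (e' i)))"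
      by (intro sum.cong) (auto simp: E.cinner_eig_comp)
    also have "\<dots> = cinner (?s x) (?s x)"
      by (rule E.parseval[symmetric])
    finally show ?thesis by (simp only: cinner_self)
  qed
  have orth: "cinner (?s x) (?s y) = 0" if "x \<noteq> y" for x y
  proof -
    have "cinner (?s x) (?s y) = (\<Sum>i\<in>UNIV. cinner (?s x) (e' i) * cnj (cinner (?s y) (e' i)))"
      by (rule E.parseval)
    also have "\<dots> = 0"
      using that by (intro sum.neutral) (auto simp: E.cinner_eig_comp)
    finally show ?thesis .
  qed
  have "orthonormal_eigenvectors h B0"
    unfolding orthonormal_eigenvectors_def
  proof (intro conjI ballI)
    fix p q assume "p \<in> B0" "q \<in> B0"
    then obtain x y where xy: "p = b x" "q = b y" "?s x \<noteq> 0" "?s y \<noteq> 0"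
      by (auto simp: B0_def)
    have one: "cinner (b x) (b x) = 1"
    proof -
      have "cinner (b x) (b x) = of_real (1 / (norm (?s x))\<^sup>2) * cinner (?s x) (?s x)"
        by (simp add: b_def cinner_simps power2_eq_square)
      then show ?thesis
        using xy(3) by (simp add: cinner_self)
    qed
    show "cinner p q = (if p = q then 1 else 0)"
    proof (cases "x = y")
      case True
      then show ?thesis using xy one by simp
    next
      case False
      then have "cinner (b x) (b y) = 0"
        by (simp add: b_def cinner_simps orth)
      then show ?thesis using xy one by auto
    qed
  next
    fix p assume "p \<in> B0"
    then obtain x where "p = b x" by (auto simp: B0_def)
    then have "h *v p = of_real x *s p"
      using eig[of x] by (simp add: b_def eigenspace_def vector_scalar_commute vector_smult_assoc
          mult.commute)
    then show "\<exists>c::real. h *v p = of_real c *s p" by blast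
  qed
  then obtain e d where ed: "eigenbasis h e d" and sub: "B0 \<subseteq> range e"
    using eigenbasis_extend[OF assms] by metis
  interpret F: eigenbasis h e d by (rule ed)
  have cases: "(\<exists>x. e i = b x \<and> ?s x \<noteq> 0) \<or> cinner t (e i) = 0" for i
  proof -
    have "cinner t (e i) = 0" if i: "e i \<notin> B0"
    proof -
      have "cinner (?s (d i)) (e i) = 0"
      proof (cases "?s (d i) = 0")
        case False
        then have "b (d i) \<in> B0" by (auto simp: B0_def)
        then obtain j where j: "b (d i) = e j" using sub by auto
        then have "j \<noteq> i" using i \<open>b (d i) \<in> B0\<close> by auto
        then have "cinner (b (d i)) (e i) = 0"
          using j F.orthonormal by simp
        then show ?thesis using False by (simp add: b_def cinner_simps)
      qed (simp add: cinner_simps)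
      then show ?thesis by (simp add: F.cinner_eig_comp)
    qed
    then show ?thesis by (auto simp: B0_def)
  qed
  define c where "c i = Re (cinner t (e i))" for i
  have c: "cinner t (e i) = of_real (c i)" for i
  proof -
    have "Im (cinner t (e i)) = 0"
      using cases[of i] by (auto simp: b_def cinner_simps ts)
    then show ?thesis by (simp add: c_def complex_eq_iff)
  qed
  have "i = j" if ij: "d i = d j" "c i \<noteq> 0" "c j \<noteq> 0" for i j
  proof -
    \<comment> \<open>A basis vector not orthogonal to \<open>t\<close> is determined by its
      eigenvalue, so there is at most one per eigenvalue.\<close>
    have form: "e k = b (d k)" if k: "c k \<noteq> 0" for k
    proof -
      obtain x where x: "e k = b x" "?s x \<noteq> 0"
        using cases[of k] c[of k] k by auto
      have "e k \<in> eigenspace h (of_real x)"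
        using eig[of x] x(1) by (simp add: b_def eigenspace_def vector_scalar_commute
            vector_smult_assoc mult.commute)
      then have "d k = x"
        using F.orthonormal[of k k] by (auto simp: F.eigenspace_iff)
      then show ?thesis using x by simp
    qed
    have "e i = e j" using form ij by simp
    then show ?thesis
      using F.orthonormal[of i j] F.orthonormal[of j j] by (auto split: if_splits)
  qed
  with c have "adapted_eigenbasis h e d t c"
    by unfold_locales
  then show thesis by (rule that)
qed

section \<open>The equations in eigenbasis coordinates\<close>

lemma conj_transpose_mult: "conj_transpose (A ** B) = conj_transpose B ** conj_transpose A"
  by (simp add: conj_transpose_def matrix_matrix_mult_def vec_eq_iff mult.commute)

lemma conj_transpose_conj_transpose [simp]: "conj_transpose (conj_transpose A) = A"
  by (simp add: conj_transpose_def vec_eq_iff)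

lemma outer_mult_vec: "outer (A *v x) (B *v y) = A ** outer x y ** conj_transpose B"
proof -
  have "(A ** outer x y ** conj_transpose B) $ i $ j = outer (A *v x) (B *v y) $ i $ j" for i j
  proof -
    have "(A ** outer x y) $ i $ k = (A *v x) $ i * cnj (y $ k)" for k
      by (simp add: outer_def matrix_matrix_mult_def matrix_vector_mult_def sum_distrib_right
          mult.assoc)
    then have "(A ** outer x y ** conj_transpose B) $ i $ j =
        (\<Sum>k\<in>UNIV. (A *v x) $ i * cnj (y $ k) * cnj (B $ j $ k))"
      by (simp add: matrix_matrix_mult_def[of "A ** outer x y"] conj_transpose_def)
    also have "\<dots> = outer (A *v x) (B *v y) $ i $ j"
      by (simp add: outer_def matrix_vector_mult_def[of B] sum_distrib_left mult_ac)
    finally show ?thesis .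
  qed
  then show ?thesis by (simp add: vec_eq_iff)
qed

lemma mat_mult_vec: "mat a *v x = a *s x"
  by (simp add: vec_eq_iff matrix_vector_mult_def mat_def mult_delta_left)

definition diag_mat :: "('n \<Rightarrow> real) \<Rightarrow> complex^'n^'n" where
  "diag_mat d = (\<chi> i j. if i = j then of_real (d i) else 0)"

lemma diag_mat_mult: "(diag_mat d ** A) $ i $ j = of_real (d i) * A $ i $ j"
  by (simp add: diag_mat_def matrix_matrix_mult_def mult_delta_left)

lemma mult_diag_mat: "(A ** diag_mat d) $ i $ j = A $ i $ j * of_real (d j)"
  by (simp add: diag_mat_def matrix_matrix_mult_def mult_delta_right)

lemma diag_mat_mult_vec: "(diag_mat d *v x) $ i = of_real (d i) * x $ i"
  by (simp add: diag_mat_def matrix_vector_mult_def mult_delta_left)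

section \<open>Transport of the equations by the unitary base change\<close>

context eigenbasis
begin

lemma mult_U: "h ** U = U ** diag_mat d"
proof -
  have "(h ** U) $ i $ j = (h *v e j) $ i" for i j
    by (simp add: matrix_matrix_mult_def matrix_vector_mult_def U_def)
  then show ?thesis
    by (simp add: vec_eq_iff mult_diag_mat eigenvector U_def mult.commute)
qed

lemma mult_U_cancel:
  "A ** conj_transpose U ** U = A" "A ** U ** conj_transpose U = A"
  by (simp_all add: conj_transpose_U_mult U_mult_conj_transpose flip: matrix_mul_assoc)

lemma diagonalization: "h = U ** diag_mat d ** conj_transpose U"
  by (simp add: mult_U_cancel flip: mult_U)

text \<open>Reconciles \<open>trace h\<close> in the equations with \<open>Re (trace h)\<close> in
  \<open>v_eig\<close>: by cyclicity the trace is the sum of the \<open>d i\<close>.\<close>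

lemma trace_real: "trace h = of_real (Re (trace h))"
proof -
  have "trace h = trace (conj_transpose U ** (U ** diag_mat d))"
    by (subst diagonalization) (rule trace_mul_sym)
  also have "\<dots> = trace (diag_mat d)"
    by (simp add: matrix_mul_assoc conj_transpose_U_mult)
  also have "\<dots> = of_real (\<Sum>i\<in>UNIV. d i)"
    by (simp add: trace_def diag_mat_def)
  finally show ?thesis by simp
qed

definition conjU :: "complex^'n^'n \<Rightarrow> complex^'n^'n" where
  "conjU f = U ** f ** conj_transpose U"

lemma linear_conjU: "linear conjU"
proof -
  have "linear (\<lambda>f. U ** f)" "linear (\<lambda>f. f ** conj_transpose U)"
    by (rule linearI; simp add: matrix_matrix_mult_def vec_eq_iff sum.distrib
        algebra_simps scaleR_sum_right)+
  then show ?thesis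
    unfolding conjU_def using linear_compose[of "(**) U" "\<lambda>f. f ** conj_transpose U"]
    by (simp add: o_def)
qed

lemma conjU_inverse: "conj_transpose U ** conjU f ** U = f" "conjU (conj_transpose U ** f ** U) = f"
  by (simp_all add: conjU_def matrix_mul_assoc conj_transpose_U_mult U_mult_conj_transpose
      mult_U_cancel)

lemma conjU_eq_iff: "conjU f = conjU g \<longleftrightarrow> f = g"
  by (metis conjU_inverse(1))

lemma conj_transpose_conjU: "conj_transpose (conjU f) = conjU (conj_transpose f)"
  by (simp add: conjU_def conj_transpose_mult matrix_mul_assoc)

lemma conjU_mult_vec: "conjU f *v (U *v x) = U *v (f *v x)"
  by (simp add: conjU_def matrix_vector_mul_assoc mult_U_cancel)

lemma conjU_mem_unitary_algebra: "conjU f \<in> unitary_algebra \<longleftrightarrow> f \<in> unitary_algebra"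
  by (simp add: unitary_algebra_def conj_transpose_conjU conjU_eq_iff
      flip: linear_neg[OF linear_conjU])

lemma commutator_conjU: "h ** conjU f - conjU f ** h = conjU (diag_mat d ** f - f ** diag_mat d)"
proof -
  have "h ** conjU f = conjU (diag_mat d ** f)"
    by (simp add: conjU_def matrix_mul_assoc mult_U)
  moreover have "conjU f ** h = conjU (f ** diag_mat d)"
    by (subst diagonalization) (simp add: conjU_def matrix_mul_assoc mult_U_cancel)
  ultimately show ?thesis
    by (simp add: linear_diff[OF linear_conjU])
qed

lemma outer_U: "outer (U *v x) (U *v y) = conjU (outer x y)"
  by (simp add: conjU_def outer_mult_vec)

lemma U_mult_vec_eq_iff: "U *v x = U *v y \<longleftrightarrow> x = y"
  by (metis conj_transpose_U_mult matrix_vector_mul_assoc matrix_vector_mul_lid)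

lemma polynomial_mult_U:
  "(h ** h + mat (trace h) ** h + mat (of_real v)) *v (U *v w) =
     U *v (\<chi> i. of_real ((d i)\<^sup>2 + Re (trace h) * d i + v) * w $ i)"
proof -
  let ?D = "diag_mat d"
  have hU: "h *v (U *v x) = U *v (?D *v x)" for x
    by (simp add: matrix_vector_mul_assoc mult_U)
  have "(h ** h + mat (trace h) ** h + mat (of_real v)) *v (U *v w) =
      h *v (h *v (U *v w)) + trace h *s (h *v (U *v w)) + of_real v *s (U *v w)"
    by (simp add: matrix_vector_mult_add_rdistrib mat_mult_vec flip: matrix_vector_mul_assoc)
  also have "\<dots> = U *v (?D *v (?D *v w) + trace h *s (?D *v w) + of_real v *s w)"
    by (simp add: hU matrix_vector_right_distrib vector_scalar_commute)
  also have "?D *v (?D *v w) + trace h *s (?D *v w) + of_real v *s w =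
      (\<chi> i. of_real ((d i)\<^sup>2 + Re (trace h) * d i + v) * w $ i)"
    by (subst trace_real) (simp add: vec_eq_iff diag_mat_mult_vec power2_eq_square algebra_simps)
  finally show ?thesis .
qed

end

section \<open>The solution spaces in coordinates\<close>

context adapted_eigenbasis
begin

definition coord_sol :: "real \<Rightarrow> ((complex^'n) \<times> (complex^'n^'n)) set" where
  "coord_sol v = {(w, f).
     (\<forall>i j. f $ i $ j = - cnj (f $ j $ i)) \<and>
     (\<forall>i j. of_real (d i - d j) * f $ i $ j + of_real (c i) * cnj (w $ j)
        + w $ i * of_real (c j) = 0) \<and>
     (\<forall>i. (\<Sum>j\<in>UNIV. f $ i $ j * of_real (c j)) =
        of_real ((d i)\<^sup>2 + Re (trace h) * d i + v) * w $ i)}"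

lemma t_eq: "t = U *v (\<chi> i. of_real (c i))"
  using expansion[of t] by (simp add: U_mult_vec coeff)

text \<open>Since \<open>U\<close> is unitary, commutators, outer products, skew-Hermitian matrices
  and the action on vectors are all compatible with conjugation by \<open>U\<close>; it remains to
  compare entries.\<close>

lemma mem_sol_space_iff: "(U *v w, conjU f) \<in> sol_space h t v \<longleftrightarrow> (w, f) \<in> coord_sol v"
proof -
  let ?t = "(\<chi> i. of_real (c i)) :: complex^'n"
  let ?q = "\<chi> i. of_real ((d i)\<^sup>2 + Re (trace h) * d i + v) * w $ i"
  let ?E = "diag_mat d ** f - f ** diag_mat d + outer ?t w + outer w ?t"
  have "h ** conjU f - conjU f ** h + outer t (U *v w) + outer (U *v w) t = conjU ?E"
    by (simp add: t_eq commutator_conjU outer_U linear_add[OF linear_conjU])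
  then have "0 = h ** conjU f - conjU f ** h + outer t (U *v w) + outer (U *v w) t \<longleftrightarrow> ?E = 0"
    using conjU_eq_iff[of 0 ?E] linear_0[OF linear_conjU] by auto
  also have "\<dots> \<longleftrightarrow> (\<forall>i j. of_real (d i - d j) * f $ i $ j + of_real (c i) * cnj (w $ j)
        + w $ i * of_real (c j) = 0)"
    by (simp add: vec_eq_iff diag_mat_mult mult_diag_mat outer_def algebra_simps)
  finally have 1: "0 = h ** conjU f - conjU f ** h + outer t (U *v w) + outer (U *v w) t \<longleftrightarrow>
      (\<forall>i j. of_real (d i - d j) * f $ i $ j + of_real (c i) * cnj (w $ j)
        + w $ i * of_real (c j) = 0)" .
  have "0 = - (conjU f *v t) + (h ** h + mat (trace h) ** h + mat (of_real v)) *v (U *v w) \<longleftrightarrow>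
      U *v (f *v ?t) = U *v ?q"
    by (subst t_eq) (auto simp: conjU_mult_vec polynomial_mult_U)
  also have "\<dots> \<longleftrightarrow> (\<forall>i. (\<Sum>j\<in>UNIV. f $ i $ j * of_real (c j)) =
        of_real ((d i)\<^sup>2 + Re (trace h) * d i + v) * w $ i)"
    unfolding U_mult_vec_eq_iff by (simp add: vec_eq_iff matrix_vector_mult_def)
  finally have 2: "0 = - (conjU f *v t) + (h ** h + mat (trace h) ** h + mat (of_real v)) *v (U *v w)
      \<longleftrightarrow> (\<forall>i. (\<Sum>j\<in>UNIV. f $ i $ j * of_real (c j)) =
        of_real ((d i)\<^sup>2 + Re (trace h) * d i + v) * w $ i)" .
  have 3: "f \<in> unitary_algebra \<longleftrightarrow> (\<forall>i j. f $ i $ j = - cnj (f $ j $ i))"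
  proof -
    have "f \<in> unitary_algebra \<longleftrightarrow> (\<forall>i j. cnj (f $ j $ i) = - f $ i $ j)"
      by (simp add: unitary_algebra_def conj_transpose_def vec_eq_iff)
    then show ?thesis by (metis minus_minus)
  qed
  show ?thesis
    unfolding sol_space_def coord_sol_def mem_Collect_eq case_prod_conv conjU_mem_unitary_algebra
    by (simp only: 1 2 3)
qed

definition change_basis :: "(complex^'n) \<times> (complex^'n^'n) \<Rightarrow> (complex^'n) \<times> (complex^'n^'n)" where
  "change_basis p = (U *v fst p, conjU (snd p))"

lemma linear_change_basis: "linear change_basis"
  by (rule linearI) (simp_all add: change_basis_def matrix_vector_right_distrib
      linear_add[OF linear_conjU] linear_cmul[OF linear_conjU] scaleR_eq_vector_smult
      vector_scalar_commute)

lemma inj_change_basis: "inj change_basis"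
  by (rule injI) (simp add: change_basis_def U_mult_vec_eq_iff conjU_eq_iff prod_eq_iff)

lemma sol_space_eq: "sol_space h t v = change_basis ` coord_sol v"
proof (intro equalityI subsetI)
  fix p assume p: "p \<in> sol_space h t v"
  obtain w f where wf: "p = (w, f)" by (cases p)
  have "p = change_basis (conj_transpose U *v w, conj_transpose U ** f ** U)"
    by (simp add: wf change_basis_def conjU_inverse matrix_vector_mul_assoc U_mult_conj_transpose)
  moreover from this have "(conj_transpose U *v w, conj_transpose U ** f ** U) \<in> coord_sol v"
    using p mem_sol_space_iff by (simp add: change_basis_def)
  ultimately show "p \<in> change_basis ` coord_sol v" by blast
next
  fix p assume "p \<in> change_basis ` coord_sol v"
  then show "p \<in> sol_space h t v"
    by (auto simp: change_basis_def mem_sol_space_iff)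
qed

lemma sol_space0_eq: "sol_space0 h t v = change_basis ` {p \<in> coord_sol v. fst p = 0}"
proof -
  have "U *v w = 0 \<longleftrightarrow> w = 0" for w
    using U_mult_vec_eq_iff[of w 0] by simp
  then show ?thesis
    unfolding sol_space0_def sol_space_eq by (force simp: change_basis_def)
qed

lemma dim_sol_space:
  "dim (sol_space h t v) = dim (coord_sol v)"
  "dim (sol_space0 h t v) = dim {p \<in> coord_sol v. fst p = 0}"
  unfolding sol_space_eq sol_space0_eq
  by (intro dim_image_eq linear_change_basis inj_on_subset[OF inj_change_basis] subset_UNIV)+

end

section \<open>Counting dimensions\<close>

text \<open>The orthogonal complement \<open>?C\<close> of the kernel within \<open>S\<close> is
  mapped isomorphically onto the image.\<close>

lemma dim_image_kernel:
  fixes f :: "'a::euclidean_space \<Rightarrow> 'b::euclidean_space"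
  assumes f: "linear f" and S: "subspace S"
  shows "dim S = dim {x \<in> S. f x = 0} + dim (f ` S)"
proof -
  let ?N = "{x \<in> S. f x = 0}" and ?C = "{y \<in> S. \<forall>x \<in> {x \<in> S. f x = 0}. orthogonal x y}"
  have N: "subspace ?N"
    using S by (auto simp: subspace_def linear_0[OF f] linear_add[OF f] linear_cmul[OF f])
  have C: "subspace ?C"
    using S by (auto simp: subspace_def orthogonal_def inner_simps)
  have NC: "dim ?C + dim ?N = dim S"
    using N S by (rule dim_subspace_orthogonal_to_vectors) auto
  have "inj_on f ?C"
  proof (rule inj_onI)
    fix x y assume xy: "x \<in> ?C" "y \<in> ?C" "f x = f y"
    then have C': "x - y \<in> ?C"
      by (intro subspace_diff[OF C])
    then have "x - y \<in> ?N"
      using xy by (simp add: linear_diff[OF f])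
    with C' have "orthogonal (x - y) (x - y)"
      by blast
    then show "x = y"
      by (simp add: orthogonal_def)
  qed
  then have "dim (f ` ?C) = dim ?C"
    using C by (intro dim_image_eq f) (simp add: span_eq_iff[THEN iffD2])
  moreover have "f ` S \<subseteq> f ` ?C"
  proof
    fix z assume "z \<in> f ` S"
    then obtain x where x: "x \<in> S" "z = f x" by blast
    obtain p q where pq: "p \<in> span ?N" "\<And>w. w \<in> span ?N \<Longrightarrow> orthogonal q w" "x = p + q"
      by (rule orthogonal_subspace_decomp_exists[of ?N x]) (rule that; simp)
    have p: "p \<in> ?N"
      using pq(1) N by (simp add: span_eq_iff[THEN iffD2])
    have "q = x - p" using pq(3) by simp
    then have "q \<in> S"
      using S x(1) p by (simp add: subspace_diff)
    moreover have "f q = z"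
      using pq(3) p x(2) by (simp add: linear_add[OF f])
    moreover have "orthogonal w q" if "w \<in> ?N" for w
      using pq(2)[OF span_base[OF that]] orthogonal_commute by blast
    ultimately show "z \<in> f ` ?C" by blast
  qed
  then have "f ` S = f ` ?C" by blast
  ultimately show ?thesis using NC by simp
qed

lemma card_eq_sum_fibres:
  assumes "finite S" "finite T" "g ` S \<subseteq> T"
  shows "card S = (\<Sum>y\<in>T. card {x \<in> S. g x = y})"
  using sum.group[OF assms, of "\<lambda>_. 1 :: nat"] by simp

lemma dim_supported_matrices:
  fixes R :: "('m::finite \<times> 'n::finite) set"
  shows "dim {g :: real^'n^'m. \<forall>i j. (i, j) \<notin> R \<longrightarrow> g $ i $ j = 0} = card R"
proof -
  let ?a = "\<lambda>(i, j). axis i (axis j 1) :: real^'n^'m"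
  have inj: "inj_on ?a R"
    by (auto simp: inj_on_def axis_eq_axis)
  have "?a ` R \<subseteq> Basis"
    by (auto simp: Basis_vec_def)
  then have "dim {g :: real^'n^'m. \<forall>b\<in>Basis. b \<notin> ?a ` R \<longrightarrow> g \<bullet> b = 0} = card (?a ` R)"
    by (rule dim_substandard)
  moreover have "(\<forall>b\<in>Basis. b \<notin> ?a ` R \<longrightarrow> g \<bullet> b = 0) \<longleftrightarrow>
      (\<forall>i j. (i, j) \<notin> R \<longrightarrow> g $ i $ j = 0)" for g :: "real^'n^'m"
  proof -
    have "axis i (axis j 1) \<in> ?a ` R \<longleftrightarrow> (i, j) \<in> R" for i j
      by (force simp: axis_eq_axis)
    moreover have "(\<forall>b\<in>Basis. P b) \<longleftrightarrow> (\<forall>i j. P (axis i (axis j 1)))"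
      for P :: "real^'n^'m \<Rightarrow> bool"
      by (auto simp: Basis_vec_def)
    ultimately show ?thesis
      by (simp add: inner_axis)
  qed
  ultimately show ?thesis
    using card_image[OF inj] by simp
qed

text \<open>A real basis consists of the imaginary axis vectors over \<open>A \<union> F\<close> and
  the real ones over \<open>F\<close>.\<close>

lemma dim_vectors_real_complex:
  fixes A F :: "'n::finite set"
  assumes "A \<inter> F = {}"
  shows "dim {w :: complex^'n. \<forall>i. (i \<in> A \<longrightarrow> Re (w $ i) = 0) \<and> (i \<notin> A \<union> F \<longrightarrow> w $ i = 0)} =
    card A + 2 * card F"
proof -
  let ?D1 = "(\<lambda>i. axis i \<i> :: complex^'n) ` (A \<union> F)" and ?D2 = "(\<lambda>i. axis i 1 :: complex^'n) ` F"
  have "?D1 \<union> ?D2 \<subseteq> Basis"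
    by (auto simp: Basis_vec_def Basis_complex_def)
  then have "dim {w :: complex^'n. \<forall>b\<in>Basis. b \<notin> ?D1 \<union> ?D2 \<longrightarrow> w \<bullet> b = 0} = card (?D1 \<union> ?D2)"
    by (rule dim_substandard)
  moreover have "(\<forall>b\<in>Basis. b \<notin> ?D1 \<union> ?D2 \<longrightarrow> w \<bullet> b = 0) \<longleftrightarrow>
      (\<forall>i. (i \<in> A \<longrightarrow> Re (w $ i) = 0) \<and> (i \<notin> A \<union> F \<longrightarrow> w $ i = 0))" for w :: "complex^'n"
  proof -
    have "(\<forall>b\<in>Basis. b \<notin> ?D1 \<union> ?D2 \<longrightarrow> w \<bullet> b = 0) \<longleftrightarrow>
        (\<forall>i. (i \<notin> F \<longrightarrow> Re (w $ i) = 0) \<and> (i \<notin> A \<union> F \<longrightarrow> Im (w $ i) = 0))"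
      by (auto simp: Basis_vec_def Basis_complex_def inner_axis axis_eq_axis image_iff)
    then show ?thesis
      using assms by (auto simp: complex_eq_iff)
  qed
  moreover have "card (?D1 \<union> ?D2) = card A + 2 * card F"
  proof -
    have "card (?D1 \<union> ?D2) = card ?D1 + card ?D2"
      by (rule card_Un_disjoint) (auto simp: axis_eq_axis)
    also have "\<dots> = card (A \<union> F) + card F"
      by (simp add: card_image inj_on_def axis_eq_axis)
    finally show ?thesis
      using assms by (simp add: card_Un_disjoint)
  qed
  ultimately show ?thesis by simp
qed

section \<open>The solutions with \<open>w = 0\<close>\<close>

context adapted_eigenbasis
begin

lemma coord_solD:
  assumes "(w, f) \<in> coord_sol v"
  shows "f $ i $ j = - cnj (f $ j $ i)"
    and "of_real (d i - d j) * f $ i $ j + of_real (c i) * cnj (w $ j) + w $ i * of_real (c j) = 0"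
    and "(\<Sum>j\<in>UNIV. f $ i $ j * of_real (c j)) =
        of_real ((d i)\<^sup>2 + Re (trace h) * d i + v) * w $ i"
  using assms unfolding coord_sol_def by blast+

lemma eig_comp_eq_0_iff: "eig_comp h t a = 0 \<longleftrightarrow> (\<forall>i. d i = a \<longrightarrow> c i = 0)"
  unfolding eq_iff_cinner[of _ 0] by (simp add: cinner_eig_comp coeff cinner_simps)

text \<open>By Parseval, each squared norm is the sum of the \<open>(c i)\<^sup>2\<close> with that
  eigenvalue. The resulting sum over indices is the form in which it arises from the second
  equation.\<close>

lemma v_eig_eq:
  "v_eig h t v a = a\<^sup>2 + Re (trace h) * a + v + (\<Sum>i | d i \<noteq> a. (c i)\<^sup>2 / (a - d i))"
proof -
  have norm: "(norm (eig_comp h t y))\<^sup>2 = (\<Sum>i | d i = y. (c i)\<^sup>2)" for y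
  proof -
    have "of_real ((norm (eig_comp h t y))\<^sup>2) =
        (\<Sum>i\<in>UNIV. cinner (eig_comp h t y) (e i) * cnj (cinner (eig_comp h t y) (e i)))"
      unfolding cinner_self[symmetric] by (rule parseval)
    also have "\<dots> = (\<Sum>i | d i = y. of_real ((c i)\<^sup>2))"
      by (rule sum.mono_neutral_cong_right)
        (auto simp: cinner_eig_comp coeff power2_eq_square)
    finally show ?thesis
      by (metis of_real_eq_iff of_real_sum)
  qed
  have "(\<Sum>y\<in>eigenvalues h - {a}. (norm (eig_comp h t y))\<^sup>2 / (a - y)) =
      (\<Sum>y\<in>range d - {a}. \<Sum>i\<in>{i \<in> {i. d i \<noteq> a}. d i = y}. (c i)\<^sup>2 / (a - d i))"
    unfolding eigenvalues_eq norm sum_divide_distrib by (intro sum.cong) auto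
  also have "\<dots> = (\<Sum>i | d i \<noteq> a. (c i)\<^sup>2 / (a - d i))"
    by (rule sum.group) auto
  finally show ?thesis
    by (simp add: v_eig_def)
qed

definition kernel_pairs :: "('n \<times> 'n) set" where
  "kernel_pairs = {(i, j). d i = d j \<and> c i = 0 \<and> c j = 0}"

text \<open>
  A skew-Hermitian matrix \<open>f\<close> is encoded by the real matrix \<open>g = Re f + Im f\<close>: the real part of \<open>f\<close>
  is the antisymmetric part of \<open>g\<close>, the imaginary part of \<open>f\<close> the symmetric one.
\<close>

lemma dim_kernel: "dim {p \<in> coord_sol v. fst p = 0} = card kernel_pairs"
proof -
  let ?S = "{g :: real^'n^'n. \<forall>i j. (i, j) \<notin> kernel_pairs \<longrightarrow> g $ i $ j = 0}"
  define G :: "real^'n^'n \<Rightarrow> (complex^'n) \<times> (complex^'n^'n)" where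
    "G g = (0, \<chi> i j. Complex ((g $ i $ j - g $ j $ i) / 2) ((g $ i $ j + g $ j $ i) / 2))" for g
  have Re_G: "Re (snd (G g) $ i $ j) = (g $ i $ j - g $ j $ i) / 2"
    and Im_G: "Im (snd (G g) $ i $ j) = (g $ i $ j + g $ j $ i) / 2" for g i j
    by (simp_all add: G_def)
  have lin: "linear G"
    by (rule linearI) (simp_all add: G_def vec_eq_iff complex_eq_iff field_simps)
  have "inj G"
  proof (rule injI)
    fix g g' assume "G g = G g'"
    then have "Re (snd (G g) $ i $ j) = Re (snd (G g') $ i $ j)"
      "Im (snd (G g) $ i $ j) = Im (snd (G g') $ i $ j)" for i j
      by simp_all
    then have "g $ i $ j = g' $ i $ j" for i j
      unfolding Re_G Im_G by (smt (verit) field_sum_of_halves)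
    then show "g = g'" by (simp add: vec_eq_iff)
  qed
  have "{p \<in> coord_sol v. fst p = 0} = G ` ?S"
  proof (intro equalityI subsetI)
    fix p assume "p \<in> {p \<in> coord_sol v. fst p = 0}"
    then obtain f where p: "p = (0, f)" and sol: "(0, f) \<in> coord_sol v"
      by (cases p) auto
    have skew: "f $ i $ j = - cnj (f $ j $ i)" for i j
      using coord_solD(1)[OF sol] .
    have block: "f $ i $ j = 0" if "d i \<noteq> d j" for i j
      using coord_solD(2)[OF sol, of i j] that by simp
    \<comment> \<open>In row \<open>i\<close> of the second equation, \<open>block\<close> removes
      the terms of other eigenvalues and \<open>coeff_unique\<close> all others but the
      \<open>j\<close>-th.\<close>
    have col: "f $ i $ j = 0" if "c j \<noteq> 0" for i j
    proof (cases "d i = d j")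
      case True
      have "0 = (\<Sum>k\<in>UNIV. f $ i $ k * of_real (c k))"
        using coord_solD(3)[OF sol, of i] by simp
      also have "\<dots> = (\<Sum>k\<in>UNIV. if k = j then f $ i $ j * of_real (c j) else 0)"
      proof (intro sum.cong refl)
        fix k
        show "f $ i $ k * of_real (c k) = (if k = j then f $ i $ j * of_real (c j) else 0)"
        proof (cases "d k = d j")
          case True
          then have "k = j \<or> c k = 0"
            using that coeff_unique[of k j] by blast
          then show ?thesis using that by auto
        next
          case False
          then have "f $ i $ k = 0" "k \<noteq> j"
            using \<open>d i = d j\<close> block[of i k] by metis+
          then show ?thesis by simp
        qed
      qed
      finally show ?thesis using that by simp
    qed (rule block)
    define g where "g = (\<chi> i j. Re (f $ i $ j) + Im (f $ i $ j))"
    have "g \<in> ?S"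
    proof -
      \<comment> \<open>For \<open>c i \<noteq> 0\<close> the entry vanishes because column
        \<open>i\<close> does and \<open>f\<close> is skew-Hermitian.\<close>
      have "f $ i $ j = 0" if "(i, j) \<notin> kernel_pairs" for i j
        using that block[of i j] col[of j i] col[of i j] skew[of i j]
        by (auto simp: kernel_pairs_def)
      then show ?thesis by (simp add: g_def)
    qed
    moreover have "p = G g"
    proof -
      have "f $ i $ j = snd (G g) $ i $ j" for i j
        using skew[of j i] by (simp add: complex_eq_iff Re_G Im_G g_def)
      moreover have "fst (G g) = 0"
        by (simp add: G_def)
      ultimately show ?thesis
        by (simp add: p prod_eq_iff vec_eq_iff)
    qed
    ultimately show "p \<in> G ` ?S" by blast
  next
    fix p assume "p \<in> G ` ?S"
    then obtain g where g: "g \<in> ?S" "p = G g" by blast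
    define f where "f = snd p"
    have p: "p = (0, f)"
      using g(2) by (simp add: f_def G_def)
    have supp: "f $ i $ j = 0" if "(i, j) \<notin> kernel_pairs" for i j
    proof -
      have "(j, i) \<notin> kernel_pairs" using that by (auto simp: kernel_pairs_def)
      with that g show ?thesis by (simp add: f_def Re_G Im_G complex_eq_iff)
    qed
    have "f $ i $ j = - cnj (f $ j $ i)" for i j
      by (simp add: f_def g(2) Re_G Im_G complex_eq_iff field_simps)
    moreover have "of_real (d i - d j) * f $ i $ j + of_real (c i) * cnj (0 $ j) + 0 $ i * of_real (c j) = 0"
      for i j
      using supp[of i j] by (auto simp: kernel_pairs_def)
    moreover have "(\<Sum>j\<in>UNIV. f $ i $ j * of_real (c j)) =
        of_real ((d i)\<^sup>2 + Re (trace h) * d i + v) * 0 $ i" for i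
      using supp by (auto simp: kernel_pairs_def intro!: sum.neutral)
    ultimately have "(0, f) \<in> coord_sol v"
      unfolding coord_sol_def by blast
    then show "p \<in> {p \<in> coord_sol v. fst p = 0}"
      by (simp add: p)
  qed
  then have "dim {p \<in> coord_sol v. fst p = 0} = dim (G ` ?S)" by simp
  also have "\<dots> = dim ?S"
    using lin \<open>inj G\<close> by (intro dim_image_eq) (auto intro: inj_on_subset)
  finally show ?thesis
    by (simp only: dim_supported_matrices)
qed

section \<open>The vectors \<open>w\<close> that occur in solutions\<close>

text \<open>The third case of \<open>tau\<close>: here \<open>w $ i\<close> will be an arbitrary
  complex number, which accounts for the factor 2.\<close>

definition free_coords :: "real \<Rightarrow> 'n set" where
  "free_coords v = {i. eig_comp h t (d i) = 0 \<and> v_eig h t v (d i) = 0}"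

lemma fst_coord_sol:
  "fst ` coord_sol v =
    {w. \<forall>i. (i \<in> {i. c i \<noteq> 0} \<longrightarrow> Re (w $ i) = 0) \<and> (i \<notin> {i. c i \<noteq> 0} \<union> free_coords v \<longrightarrow> w $ i = 0)}"
  (is "_ = ?W")
proof -
  \<comment> \<open>For \<open>d i \<noteq> d j\<close> this is the value of
    \<open>f $ i $ j\<close> forced by the first equation.\<close>
  let ?f = "\<lambda>w i j. - (of_real (c i) * cnj (w $ j) + w $ i * of_real (c j)) / of_real (d i - d j)"
  \<comment> \<open>The forced entries produce the sum in \<open>v_eig\<close>, so a row with
    \<open>c i = 0\<close> whose other terms vanish reduces to \<open>v_eig h t v (d i)\<close>
    times \<open>w $ i\<close> being zero.\<close>
  have row: "(\<Sum>j | d j \<noteq> d i. ?f w i j * of_real (c j)) =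
      of_real ((d i)\<^sup>2 + Re (trace h) * d i + v - v_eig h t v (d i)) * w $ i"
    if "c i = 0" for w :: "complex^'n" and i
  proof -
    have "(d i)\<^sup>2 + Re (trace h) * d i + v - v_eig h t v (d i) =
        - (\<Sum>j | d j \<noteq> d i. (c j)\<^sup>2 / (d i - d j))"
      by (simp add: v_eig_eq)
    then show ?thesis
      using that by (simp add: sum_distrib_left sum_distrib_right sum_negf power2_eq_square mult_ac)
  qed
  show ?thesis
  proof (intro equalityI subsetI)
    fix w assume "w \<in> fst ` coord_sol v"
    then obtain f where sol: "(w, f) \<in> coord_sol v" by auto
    \<comment> \<open>The diagonal entry of the first equation is
      \<open>2 * c i * Re (w $ i) = 0\<close>.\<close>
    have "Re (w $ i) = 0" if "c i \<noteq> 0" for i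
      using coord_solD(2)[OF sol, of i i] that by (simp add: complex_eq_iff)
    moreover have "w $ i = 0" if i: "c i = 0" "i \<notin> free_coords v" for i
    proof (cases "eig_comp h t (d i) = 0")
      case False
      \<comment> \<open>With \<open>c i = 0\<close> and \<open>d i = d j\<close>, the first equation
        at \<open>(i, j)\<close> leaves only \<open>w $ i * of_real (c j) = 0\<close>.\<close>
      then obtain j where j: "d j = d i" "c j \<noteq> 0"
        by (auto simp: eig_comp_eq_0_iff)
      then show ?thesis
        using coord_solD(2)[OF sol, of i j] i by simp
    next
      case True
      then have zero: "c j = 0" if "d j = d i" for j
        using that by (auto simp: eig_comp_eq_0_iff)
      have "of_real ((d i)\<^sup>2 + Re (trace h) * d i + v) * w $ i =
          (\<Sum>j\<in>UNIV. f $ i $ j * of_real (c j))"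
        using coord_solD(3)[OF sol, of i] by simp
      also have "\<dots> = (\<Sum>j | d j \<noteq> d i. ?f w i j * of_real (c j))"
      proof (rule sum.mono_neutral_cong_right)
        fix j assume "j \<in> {j. d j \<noteq> d i}"
        then have "of_real (d i - d j) \<noteq> (0 :: complex)" by simp
        then have "f $ i $ j = ?f w i j"
          using coord_solD(2)[OF sol, of i j] by (simp add: field_simps add_eq_0_iff)
        then show "f $ i $ j * of_real (c j) = ?f w i j * of_real (c j)" by simp
      qed (auto simp: zero)
      also have "\<dots> = of_real ((d i)\<^sup>2 + Re (trace h) * d i + v - v_eig h t v (d i)) * w $ i"
        using i(1) by (rule row)
      finally have "of_real (v_eig h t v (d i)) * w $ i = 0"
        by (simp add: algebra_simps)
      then show ?thesis
        using True i(2) by (simp add: free_coords_def)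
    qed
    ultimately show "w \<in> ?W" by blast
  next
    fix w assume w: "w \<in> ?W"
    have re: "Re (w $ i) = 0" if "c i \<noteq> 0" for i
      using w that by blast
    have z: "w $ i = 0" if "c i = 0" "i \<notin> free_coords v" for i
      using w that by blast
    let ?q = "\<lambda>i. (d i)\<^sup>2 + Re (trace h) * d i + v"
    let ?o = "\<lambda>i. \<Sum>j | d j \<noteq> d i. ?f w i j * of_real (c j)"
    \<comment> \<open>The diagonal entries solve the second equation in the rows with \<open>c i \<noteq> 0\<close>; since \<open>x / 0 = 0\<close>,
      they vanish in the other rows.\<close>
    define f where "f = (\<chi> i j. if d i \<noteq> d j then ?f w i j
      else if i = j then (of_real (?q i) * w $ i - ?o i) / of_real (c i) else 0)"
    have f_off: "f $ i $ j = ?f w i j" if "d j \<noteq> d i" for i j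
      using that by (simp add: f_def)
    have f_block: "f $ i $ j = 0" if "d j = d i" "j \<noteq> i" for i j
      using that by (simp add: f_def)
    \<comment> \<open>If \<open>c i \<noteq> 0\<close>, every \<open>w $ j\<close> entering
      \<open>?o i\<close> with a nonzero coefficient is imaginary, as is \<open>w $ i\<close>; so
      the diagonal entry is imaginary, as a skew-Hermitian matrix requires.\<close>
    have re_diag: "Re (f $ i $ i) = 0" for i
    proof (cases "c i = 0")
      case False
      have "Re (?f w i j * of_real (c j)) = 0" for j
        using re[of i] re[of j] False
        by (cases "c j = 0") (simp_all add: Re_divide_of_real del: of_real_diff)
      then have "Re (?o i) = 0" by (simp only: Re_sum sum.neutral_const)
      then show ?thesis
        using re[OF False] by (simp add: f_def Re_divide_of_real)
    qed (simp add: f_def)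
    have skew_off: "f $ i $ j = - cnj (f $ j $ i)" if "i \<noteq> j" for i j
    proof (cases "d i = d j")
      case False
      let ?x = "- (of_real (c i) * cnj (w $ j) + w $ i * of_real (c j))"
      \<comment> \<open>Conjugating and exchanging the indices preserves the numerator, as
        \<open>c\<close> is real, and negates the denominator.\<close>
      have "cnj (?f w j i) = ?x / of_real (d j - d i)"
        by (simp add: mult.commute add.commute)
      also have "\<dots> = - ?f w i j"
        by (metis minus_diff_eq minus_divide_right of_real_minus)
      finally show ?thesis
        using False by (simp add: f_off del: of_real_diff)
    next
      case True
      then have "f $ i $ j = 0" "f $ j $ i = 0"
        using that by (simp_all add: f_block)
      then show ?thesis by simp
    qed
    have 1: "f $ i $ j = - cnj (f $ j $ i)" for i j
    proof (cases "i = j")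
      case True
      then show ?thesis using re_diag[of j] by (simp add: complex_eq_iff)
    qed (rule skew_off)
    have 2: "of_real (d i - d j) * f $ i $ j + of_real (c i) * cnj (w $ j)
        + w $ i * of_real (c j) = 0" for i j
    proof (cases "d i = d j")
      case False
      then have "of_real (d i - d j) \<noteq> (0 :: complex)" by simp
      then show ?thesis
        using False by (simp add: f_def field_simps)
    next
      case True
      \<comment> \<open>Off the diagonal of a block \<open>f\<close> is zero, so the terms in
        \<open>w\<close> must vanish by themselves. An index sharing its eigenvalue with some other
        \<open>l\<close> where \<open>c l \<noteq> 0\<close> has zero coefficient and is not
        free.\<close>
      have *: "w $ k = 0" if "d k = d l" "c l \<noteq> 0" "k \<noteq> l" for k l
      proof -
        have "c k = 0" using coeff_unique[of k l] that by blast
        moreover have "k \<notin> free_coords v"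
          using that by (auto simp: free_coords_def eig_comp_eq_0_iff)
        ultimately show ?thesis by (rule z)
      qed
      show ?thesis
      proof (cases "i = j")
        case True
        then show ?thesis
          using re[of i] by (cases "c i = 0") (simp_all add: complex_eq_iff)
      next
        case False
        then show ?thesis
          using True *[of i j] *[of j i] by (cases "c i = 0"; cases "c j = 0") auto
      qed
    qed
    have 3: "(\<Sum>j\<in>UNIV. f $ i $ j * of_real (c j)) = of_real (?q i) * w $ i" for i
    proof -
      have "(\<Sum>j\<in>UNIV. f $ i $ j * of_real (c j)) =
          (\<Sum>j\<in>{j. d j \<noteq> d i} \<union> {i}. f $ i $ j * of_real (c j))"
        by (rule sum.mono_neutral_right) (auto simp: f_block)
      also have "\<dots> = (\<Sum>j | d j \<noteq> d i. f $ i $ j * of_real (c j)) + f $ i $ i * of_real (c i)"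
        by (subst sum.union_disjoint) auto
      also have "(\<Sum>j | d j \<noteq> d i. f $ i $ j * of_real (c j)) = ?o i"
        by (rule sum.cong) (simp_all add: f_off)
      finally have sum: "(\<Sum>j\<in>UNIV. f $ i $ j * of_real (c j)) = ?o i + f $ i $ i * of_real (c i)" .
      show ?thesis
      proof (cases "c i = 0")
        case False
        then show ?thesis unfolding sum by (simp add: f_def)
      next
        case True
        \<comment> \<open>Either \<open>i\<close> is free and \<open>v_eig\<close> vanishes, or
          \<open>w $ i = 0\<close>; this closes the gap left by \<open>row\<close>.\<close>
        have "of_real (v_eig h t v (d i)) * w $ i = 0"
          using z[OF True] by (auto simp: free_coords_def)
        then show ?thesis
          unfolding sum row[OF True] using True by (simp add: algebra_simps)
      qed
    qed
    have "(w, f) \<in> coord_sol v"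
      unfolding coord_sol_def using 1 2 3 by blast
    then show "w \<in> fst ` coord_sol v" by force
  qed
qed

section \<open>Counting by eigenvalues and the final formulas\<close>

lemma subspace_coord_sol: "subspace (coord_sol v)"
proof -
  have "coord_sol v = change_basis -` sol_space h t v"
    unfolding sol_space_eq by (simp add: inj_vimage_image_eq inj_change_basis)
  then show ?thesis
    using linear_subspace_vimage[OF linear_change_basis subspace_sol_space] by simp
qed

text \<open>The pairs belonging to one eigenvalue form the square of the set of its indices with
  zero coefficient.\<close>

lemma card_kernel_pairs: "card kernel_pairs = (\<Sum>x\<in>eigenvalues h. rho h t x)"
proof -
  have "card kernel_pairs = (\<Sum>x\<in>range d. card {p \<in> kernel_pairs. d (fst p) = x})"
    by (rule card_eq_sum_fibres) auto
  also have "\<dots> = (\<Sum>x\<in>range d. rho h t x)"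
  proof (rule sum.cong[OF refl])
    fix x
    have "{p \<in> kernel_pairs. d (fst p) = x} = {i. d i = x \<and> c i = 0} \<times> {i. d i = x \<and> c i = 0}"
      by (auto simp: kernel_pairs_def)
    then have card: "card {p \<in> kernel_pairs. d (fst p) = x} = (card {i. d i = x \<and> c i = 0})\<^sup>2"
      by (simp add: card_cartesian_product power2_eq_square)
    show "card {p \<in> kernel_pairs. d (fst p) = x} = rho h t x"
    proof (cases "eig_comp h t x = 0")
      case True
      then have "{i. d i = x \<and> c i = 0} = {i. d i = x}"
        by (auto simp: eig_comp_eq_0_iff)
      then show ?thesis
        using True by (simp add: card rho_def mult_eig_eq)
    next
      case False
      then obtain j where j: "d j = x" "c j \<noteq> 0"
        by (auto simp: eig_comp_eq_0_iff)
      \<comment> \<open>Exactly one index \<open>j\<close> is removed from the block. As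
        \<open>j\<close> belongs to it, the subtraction in \<open>rho\<close> is not
        truncated.\<close>
      have "c i = 0 \<longleftrightarrow> i \<noteq> j" if "d i = x" for i
        using coeff_unique[of i j] j that by auto
      then have "{i. d i = x \<and> c i = 0} = {i. d i = x} - {j}"
        by auto
      then show ?thesis
        using False j(1) by (simp add: card rho_def mult_eig_eq)
    qed
  qed
  finally show ?thesis by (simp add: eigenvalues_eq)
qed

text \<open>Per eigenvalue, a nonzero component of \<open>t\<close> contributes one imaginary
  coordinate and no free one; a zero component makes the block free as a whole or not at all,
  depending on \<open>v_eig\<close>.\<close>

lemma card_image_coords:
  "card {i. c i \<noteq> 0} + 2 * card (free_coords v) = (\<Sum>x\<in>eigenvalues h. tau h t v x)"
proof -
  have "card {i. c i \<noteq> 0} = (\<Sum>x\<in>range d. card {i \<in> {i. c i \<noteq> 0}. d i = x})"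
    by (rule card_eq_sum_fibres) auto
  moreover have "card (free_coords v) = (\<Sum>x\<in>range d. card {i \<in> free_coords v. d i = x})"
    by (rule card_eq_sum_fibres) auto
  ultimately have "card {i. c i \<noteq> 0} + 2 * card (free_coords v) =
      (\<Sum>x\<in>range d. card {i \<in> {i. c i \<noteq> 0}. d i = x} + 2 * card {i \<in> free_coords v. d i = x})"
    by (simp add: sum.distrib sum_distrib_left)
  also have "\<dots> = (\<Sum>x\<in>range d. tau h t v x)"
  proof (rule sum.cong[OF refl])
    fix x
    show "card {i \<in> {i. c i \<noteq> 0}. d i = x} + 2 * card {i \<in> free_coords v. d i = x} = tau h t v x"
    proof (cases "eig_comp h t x = 0")
      case True
      then have "{i \<in> {i. c i \<noteq> 0}. d i = x} = {}"
        by (auto simp: eig_comp_eq_0_iff)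
      moreover have "{i \<in> free_coords v. d i = x} = (if v_eig h t v x = 0 then {i. d i = x} else {})"
        using True by (auto simp: free_coords_def)
      ultimately show ?thesis
        using True by (simp add: tau_def mult_eig_eq)
    next
      case False
      then obtain j where j: "d j = x" "c j \<noteq> 0"
        by (auto simp: eig_comp_eq_0_iff)
      have "c i \<noteq> 0 \<longleftrightarrow> i = j" if "d i = x" for i
        using coeff_unique[of i j] j that by auto
      then have "{i \<in> {i. c i \<noteq> 0}. d i = x} = {j}"
        using j(1) by auto
      moreover have "{i \<in> free_coords v. d i = x} = {}"
        using False by (auto simp: free_coords_def)
      ultimately show ?thesis
        using False by (simp add: tau_def)
    qed
  qed
  finally show ?thesis by (simp add: eigenvalues_eq)
qed

text \<open>Rank-nullity for the projection to \<open>w\<close>: the kernel yields the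
  \<open>rho\<close>, the image the \<open>tau\<close>.\<close>

lemma dim_sol_space_eq:
  "dim (sol_space0 h t v) = (\<Sum>x\<in>eigenvalues h. rho h t x)"
  "dim (sol_space h t v) = dim (sol_space0 h t v) + (\<Sum>x\<in>eigenvalues h. tau h t v x)"
proof -
  show "dim (sol_space0 h t v) = (\<Sum>x\<in>eigenvalues h. rho h t x)"
    by (simp add: dim_sol_space dim_kernel card_kernel_pairs)
  have "{i. c i \<noteq> 0} \<inter> free_coords v = {}"
    by (auto simp: free_coords_def eig_comp_eq_0_iff)
  then have "dim (fst ` coord_sol v) = (\<Sum>x\<in>eigenvalues h. tau h t v x)"
    unfolding fst_coord_sol card_image_coords[symmetric] by (rule dim_vectors_real_complex)
  then show "dim (sol_space h t v) = dim (sol_space0 h t v) + (\<Sum>x\<in>eigenvalues h. tau h t v x)"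
    using dim_image_kernel[OF linear_fst subspace_coord_sol] by (simp add: dim_sol_space)
qed

end

theorem proposition4:
  fixes h :: "complex^'n^'n" and t :: "complex^'n" and v :: real
  assumes "hermitian h"
  shows "dim (sol_space0 h t v) = (\<Sum>x\<in>eigenvalues h. rho h t x) \<and>
    dim (sol_space h t v) = dim (sol_space0 h t v) + (\<Sum>x\<in>eigenvalues h. tau h t v x)"
proof -
  obtain e d c where "adapted_eigenbasis h e d t c"
    using adapted_eigenbasis_exists[OF assms] .
  then show ?thesis
    by (simp add: adapted_eigenbasis.dim_sol_space_eq)
qed

end
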